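(* Let $\mathbb{F}$ be a field, let $0\le r\le n$, and let $P\in\mathbb{F}[X_1,\ldots,X_n]$. Suppose that $P(x)=0$ for every $x\in\{0,1\}^n$ with $w_H(x)>r$, and that $P(x_0)\neq0$ for some $x_0\in\{0,1\}^n$ with $w_H(x_0)\le r$. Then $\deg(P)\ge n-r$.
   Context: For $x\in\{0,1\}^n$, $w_H(x)$ denotes the Hamming weight of $x$, i.e. the number of coordinates equal to $1$. Points of $\{0,1\}^n$ are regarded as points of $\mathbb{F}^n$ when evaluating $P$. $\deg(P)$ is the total degree of the polynomial $P$ (which is not assumed multilinear); $r$ and $n$ are integers. *)

theory Defs
  imports "HOL-Library.Poly_Mapping" "HOL-Library.FuncSet"
begin

(* An exponent vector is a finitely supported function nat =>0 nat, and a polynomial is a finitely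
   supported assignment of coefficients to exponent vectors.  With this type, HOL-Library.Poly_Mapping
   supplies the ring structure, where multiplication is the convolution product. *)
type_synonym 'a mpoly = "(nat \<Rightarrow>\<^sub>0 nat) \<Rightarrow>\<^sub>0 'a"

(* F[X_1, ..., X_n]: only the variables with index in {1..n} may occur. *)
definition mpolys :: "nat \<Rightarrow> ('a::comm_ring_1) mpoly set" where
  "mpolys n = {P. \<forall>m \<in> Poly_Mapping.keys P. Poly_Mapping.keys m \<subseteq> {1..n}}"

definition mpoly_eval :: "('a::comm_ring_1) mpoly \<Rightarrow> (nat \<Rightarrow> 'a) \<Rightarrow> 'a" where
  "mpoly_eval P x =
     (\<Sum>m \<in> Poly_Mapping.keys P. Poly_Mapping.lookup P m *
        (\<Prod>i \<in> Poly_Mapping.keys m. x i ^ Poly_Mapping.lookup m i))"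

definition monom_degree :: "(nat \<Rightarrow>\<^sub>0 nat) \<Rightarrow> nat" where
  "monom_degree m = (\<Sum>i \<in> Poly_Mapping.keys m. Poly_Mapping.lookup m i)"

(* The inserted 0 only fixes the degree of the zero polynomial, which is 0 by convention. *)
definition total_degree :: "('a::comm_ring_1) mpoly \<Rightarrow> nat" where
  "total_degree P = Max (insert 0 (monom_degree ` Poly_Mapping.keys P))"

(* Extensional functions, so that a point is determined by its coordinates 1, ..., n. *)
definition cube :: "nat \<Rightarrow> (nat \<Rightarrow> nat) set" where
  "cube n = ({1..n} \<rightarrow>\<^sub>E {0, 1})"

definition hamming_weight :: "nat \<Rightarrow> (nat \<Rightarrow> nat) \<Rightarrow> nat" where
  "hamming_weight n x = card {i \<in> {1..n}. x i = 1}"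

(* A point of the cube read as a point of F^n.  Its values outside {1..n} are arbitrary, but the
   evaluation of a polynomial in mpolys n does not look at them. *)
definition cube_point :: "(nat \<Rightarrow> nat) \<Rightarrow> nat \<Rightarrow> 'a::comm_ring_1" where
  "cube_point x = (\<lambda>i. of_nat (x i))"

end

theory Submission
  imports Defs
begin

text \<open>
  Identify a point of the cube with its support. Among the supports at which \<open>P\<close> does not vanish,
  pick an inclusion-maximal one \<open>S\<close>, and let \<open>C\<close> be its complement; by hypothesis \<open>S\<close> has at most
  \<open>r\<close> elements, so \<open>C\<close> has at least \<open>n - r\<close>. Consider the alternating sum
  \<open>\<Sum>U \<subseteq> C. (-1)^|U| P(S \<union> U)\<close>. By maximality only the term \<open>U = {}\<close> survives, so the sum
  is \<open>P(S) \<noteq> 0\<close>. On the other hand, the sum is an iterated difference of \<open>P\<close> in the directions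
  of \<open>C\<close>, and a monomial that omits one of these variables does not see the difference in that
  direction, so it contributes \<open>0\<close>. When \<open>P\<close> has degree less than \<open>|C|\<close>, every monomial omits such a
  variable and the whole sum vanishes (\<open>alternating_sum_mpoly_eval_eq_0\<close>). Hence the degree of \<open>P\<close> is
  at least \<open>|C|\<close>. Exponents above \<open>1\<close> do no harm: at a 0-1 point a monomial depends only on its set of
  variables, and the size of that set is at most its degree.
\<close>

text \<open>The subsets of \<open>C\<close> pair off as \<open>U\<close> and \<open>insert c U\<close>; the two have opposite signs.\<close>

lemma alternating_sum_Pow_eq_0:
  fixes g :: "'b set \<Rightarrow> 'a::comm_ring_1"
  assumes "finite C" "c \<in> C"
    and insert_eq: "\<And>U. U \<subseteq> C - {c} \<Longrightarrow> g (insert c U) = g U"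
  shows "(\<Sum>U\<in>Pow C. (-1) ^ card U * g U) = 0"
proof -
  let ?D = "C - {c}" and ?h = "\<lambda>U. (-1) ^ card U * g U"
  have fin: "finite ?D" using \<open>finite C\<close> by simp
  have inj: "inj_on (insert c) (Pow ?D)"
  proof (rule inj_onI)
    fix U V assume "U \<in> Pow ?D" "V \<in> Pow ?D" and eq: "insert c U = insert c V"
    then have "c \<notin> U" "c \<notin> V" by auto
    with eq show "U = V" by (simp add: insert_ident)
  qed
  have "Pow C = Pow ?D \<union> insert c ` Pow ?D"
    using Pow_insert[of c ?D] by (simp only: insert_Diff[OF \<open>c \<in> C\<close>])
  moreover have "Pow ?D \<inter> insert c ` Pow ?D = {}" by auto
  ultimately have "sum ?h (Pow C) = sum ?h (Pow ?D) + sum ?h (insert c ` Pow ?D)"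
    using fin by (simp add: sum.union_disjoint)
  also have "sum ?h (insert c ` Pow ?D) = (\<Sum>U\<in>Pow ?D. ?h (insert c U))"
    using inj by (simp add: sum.reindex)
  also have "\<dots> = (\<Sum>U\<in>Pow ?D. - ?h U)"
  proof (rule sum.cong[OF refl])
    fix U assume U: "U \<in> Pow ?D"
    then have "finite U" "c \<notin> U" using fin finite_subset by auto
    then show "?h (insert c U) = - ?h U" using U insert_eq by simp
  qed
  finally show ?thesis by (simp add: sum_negf)
qed

text \<open>The exponents on \<open>keys m\<close> are nonzero, so a factor is \<open>0\<close> as soon as its variable is \<open>0\<close>.\<close>

lemma monomial_eval_of_bool:
  fixes m :: "nat \<Rightarrow>\<^sub>0 nat"
  shows "(\<Prod>i\<in>Poly_Mapping.keys m. of_bool (i \<in> A) ^ Poly_Mapping.lookup m i)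
       = (of_bool (Poly_Mapping.keys m \<subseteq> A) :: 'a::comm_ring_1)"
proof (cases "Poly_Mapping.keys m \<subseteq> A")
  case True
  then show ?thesis by (auto intro!: prod.neutral)
next
  case False
  then obtain i where "i \<in> Poly_Mapping.keys m" "i \<notin> A" by blast
  moreover from this have "Poly_Mapping.lookup m i \<noteq> 0" by (simp add: in_keys_iff)
  ultimately have "\<exists>i\<in>Poly_Mapping.keys m. of_bool (i \<in> A) ^ Poly_Mapping.lookup m i = (0::'a)"
    by (intro bexI[of _ i]) (simp_all add: zero_power)
  then show ?thesis using False by (simp add: prod_zero)
qed

lemma mpoly_eval_of_bool:
  "mpoly_eval P (\<lambda>i. of_bool (i \<in> A)) =
     (\<Sum>m\<in>Poly_Mapping.keys P. Poly_Mapping.lookup P m * of_bool (Poly_Mapping.keys m \<subseteq> A))"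
  by (simp add: mpoly_eval_def monomial_eval_of_bool)

lemma mpoly_eval_cong:
  assumes "P \<in> mpolys n" "\<And>i. i \<in> {1..n} \<Longrightarrow> x i = y i"
  shows "mpoly_eval P x = mpoly_eval P y"
  unfolding mpoly_eval_def
proof (intro sum.cong refl arg_cong2[where f = "(*)"] prod.cong)
  fix m i assume "m \<in> Poly_Mapping.keys P" "i \<in> Poly_Mapping.keys m"
  then have "i \<in> {1..n}" using assms(1) unfolding mpolys_def by blast
  then show "x i ^ Poly_Mapping.lookup m i = y i ^ Poly_Mapping.lookup m i"
    using assms(2) by simp
qed

lemma card_keys_le_monom_degree: "card (Poly_Mapping.keys m) \<le> monom_degree m"
proof -
  have "(\<Sum>i\<in>Poly_Mapping.keys m. 1) \<le> (\<Sum>i\<in>Poly_Mapping.keys m. Poly_Mapping.lookup m i)"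
    by (rule sum_mono) (simp add: in_keys_iff)
  then show ?thesis by (simp add: monom_degree_def)
qed

lemma monom_degree_le_total_degree:
  "m \<in> Poly_Mapping.keys P \<Longrightarrow> monom_degree m \<le> total_degree P"
  unfolding total_degree_def by (rule Max_ge) auto

text \<open>
  Each monomial has fewer than \<open>card C\<close> variables, so it misses some \<open>c \<in> C\<close>. Its value does not
  change when \<open>c\<close> is added to \<open>U\<close>, and its share of the sum cancels in pairs.
\<close>

lemma alternating_sum_mpoly_eval_eq_0:
  fixes P :: "'a::comm_ring_1 mpoly"
  assumes "finite C" and deg: "total_degree P < card C"
  shows "(\<Sum>U\<in>Pow C. (-1) ^ card U * mpoly_eval P (\<lambda>i. of_bool (i \<in> S \<union> U))) = 0"
proof -
  let ?b = "\<lambda>m U. of_bool (Poly_Mapping.keys m \<subseteq> S \<union> U) :: 'a"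
  have "(\<Sum>U\<in>Pow C. (-1) ^ card U * mpoly_eval P (\<lambda>i. of_bool (i \<in> S \<union> U)))
      = (\<Sum>U\<in>Pow C. \<Sum>m\<in>Poly_Mapping.keys P.
           Poly_Mapping.lookup P m * ((-1) ^ card U * ?b m U))"
    by (simp only: mpoly_eval_of_bool sum_distrib_left mult.left_commute)
  also have "\<dots> = (\<Sum>m\<in>Poly_Mapping.keys P.
           Poly_Mapping.lookup P m * (\<Sum>U\<in>Pow C. (-1) ^ card U * ?b m U))"
    by (subst sum.swap) (simp only: sum_distrib_left)
  also have "\<dots> = 0"
  proof (rule sum.neutral, rule ballI)
    fix m assume "m \<in> Poly_Mapping.keys P"
    then have "card (Poly_Mapping.keys m) < card C"
      using deg card_keys_le_monom_degree[of m] monom_degree_le_total_degree[of m P] by linarith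
    then have "\<not> C \<subseteq> Poly_Mapping.keys m"
      using card_mono[OF finite_keys, of C m] by linarith
    then obtain c where "c \<in> C" "c \<notin> Poly_Mapping.keys m" by blast
    then have "(\<Sum>U\<in>Pow C. (-1) ^ card U * ?b m U) = 0"
      using \<open>finite C\<close> by (intro alternating_sum_Pow_eq_0[of C c]) (auto simp: subset_insert)
    then show "Poly_Mapping.lookup P m * (\<Sum>U\<in>Pow C. (-1) ^ card U * ?b m U) = 0" by simp
  qed
  finally show ?thesis .
qed

text \<open>
  Maximality of \<open>S\<close> removes every term of the alternating sum over subsets of \<open>N - S\<close> except the
  one for the empty set, so the sum is nonzero, which a small degree would contradict.
\<close>

lemma card_complement_le_total_degree:
  fixes P :: "'a::comm_ring_1 mpoly"
  assumes "finite N" "S \<subseteq> N"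
    and nonzero: "mpoly_eval P (\<lambda>i. of_bool (i \<in> S)) \<noteq> 0"
    and maximal: "\<And>T. S \<subset> T \<Longrightarrow> T \<subseteq> N \<Longrightarrow> mpoly_eval P (\<lambda>i. of_bool (i \<in> T)) = 0"
  shows "card (N - S) \<le> total_degree P"
proof (rule ccontr)
  let ?f = "\<lambda>U. (-1) ^ card U * mpoly_eval P (\<lambda>i. of_bool (i \<in> S \<union> U))"
  assume "\<not> card (N - S) \<le> total_degree P"
  then have "0 = sum ?f (Pow (N - S))"
    using \<open>finite N\<close> by (intro alternating_sum_mpoly_eval_eq_0[symmetric]) auto
  also have "\<dots> = sum ?f {{}}"
  proof (rule sum.mono_neutral_right)
    show "\<forall>U\<in>Pow (N - S) - {{}}. ?f U = 0"
    proof
      fix U assume "U \<in> Pow (N - S) - {{}}"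
      then have "S \<subset> S \<union> U" "S \<union> U \<subseteq> N" using \<open>S \<subseteq> N\<close> by auto
      then show "?f U = 0" using maximal[of "S \<union> U"] by simp
    qed
  qed (use \<open>finite N\<close> in auto)
  also have "\<dots> = mpoly_eval P (\<lambda>i. of_bool (i \<in> S))" by simp
  finally show False using nonzero by simp
qed

theorem corollary1p4:
  fixes P :: "('a::field) mpoly" and n r :: nat
  assumes "r \<le> n"
    and "P \<in> mpolys n"
    and "\<And>x. x \<in> cube n \<Longrightarrow> hamming_weight n x > r \<Longrightarrow> mpoly_eval P (cube_point x) = 0"
    and "\<exists>x0 \<in> cube n. hamming_weight n x0 \<le> r \<and> mpoly_eval P (cube_point x0) \<noteq> 0"
  shows "total_degree P \<ge> n - r"
proof -
  let ?N = "{1..n}" and ?val = "\<lambda>A. mpoly_eval P (\<lambda>i. of_bool (i \<in> A))"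
  let ?supp = "\<lambda>x. {i \<in> {1..n}. x i = (1::nat)}"
  have val_supp: "mpoly_eval P (cube_point x) = ?val (?supp x)" if "x \<in> cube n" for x
  proof (rule mpoly_eval_cong[OF \<open>P \<in> mpolys n\<close>])
    fix i assume i: "i \<in> ?N"
    then have "x i \<in> {0, 1}" using that by (auto simp: cube_def PiE_iff)
    then show "cube_point x i = (of_bool (i \<in> ?supp x) :: 'a)"
      using i by (auto simp: cube_point_def)
  qed
  have zero: "?val A = 0" if A: "A \<subseteq> ?N" "card A > r" for A
  proof -
    let ?x = "restrict (\<lambda>i. of_bool (i \<in> A)) ?N :: nat \<Rightarrow> nat"
    have x: "?x \<in> cube n" by (auto simp: cube_def)
    have "?supp ?x = A" using A by auto
    then show ?thesis using assms(3)[OF x] val_supp[OF x] A by (simp add: hamming_weight_def)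
  qed
  let ?\<A> = "{A. A \<subseteq> ?N \<and> ?val A \<noteq> 0}"
  obtain x0 where "x0 \<in> cube n" "mpoly_eval P (cube_point x0) \<noteq> 0" using assms(4) by blast
  then have "?supp x0 \<in> ?\<A>" using val_supp by auto
  moreover have "finite ?\<A>" by (rule finite_subset[of _ "Pow ?N"]) auto
  ultimately have "\<exists>S\<in>?\<A>. ?supp x0 \<subseteq> S \<and> (\<forall>T\<in>?\<A>. S \<subseteq> T \<longrightarrow> S = T)"
    by (intro finite_has_maximal2)
  then obtain S where S: "S \<in> ?\<A>" and max: "\<forall>T\<in>?\<A>. S \<subseteq> T \<longrightarrow> S = T" by auto
  have "n - r \<le> n - card S" using zero[of S] S by force
  also have "\<dots> = card (?N - S)" using S card_Diff_subset[of S ?N] finite_subset[of S ?N] by simp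
  also have "\<dots> \<le> total_degree P"
  proof (rule card_complement_le_total_degree)
    show "?val T = 0" if "S \<subset> T" "T \<subseteq> ?N" for T using max that by auto
  qed (use S in auto)
  finally show ?thesis .
qed

end
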